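(* (Fully continuous limit of the B2 lattice Boussinesq equation, by formal expansion.) Consider the semi-discrete three-point equation for functions $u_\nu(\xi)$, $\nu\in\{-1,0,1\}$ (primes are derivatives with respect to $\xi$): $$u_1''+u_0''+u_{-1}''-3u_1'(p-u_0+u_1)+3u_{-1}'(p-u_{-1}+u_0)+(p-u_0+u_1)^3-(p-u_{-1}+u_0)^3-b_0\big[u_{-1}'-u_1'+(2p-u_{-1}+u_1)(u_{-1}-2u_0+u_1)\big]=0.$$ Put $p=1/\delta$ and $u_\nu(\xi)=v(\tau+\nu\delta,\xi)$, and expand formally in a Taylor series in $\delta$ as $\delta\to0$ (that is, $p\to\infty$). With $\xi,\tau$ kept as the variables, the leading term of the expansion gives only $(\partial_\xi-\partial_\tau)v=0$. If, before taking the limit, one introduces the new variables $x=\xi+\tau$, $t=\tau/p$, i.e. $\partial_\xi=\partial_x$, $\partial_\tau=\partial_x+\tfrac1p\partial_t$, then the leading term of the expansion becomes $$v_{xxxx}-12v_{xx}v_x-8b_0v_{xt}+12v_{tt}=0.$$ The $v_{xt}$ term is converted into a $v_{xx}$ term by the translation $\partial_t\mapsto\partial_t+\tfrac13b_0\partial_x$, which yields $$v_{xxxx}-12v_{xx}v_x-\tfrac43b_0^2v_{xx}+12v_{tt}=0,$$ the Boussinesq equation with a mass term.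
   Context: The three-point equation is the straight semi-continuous limit of the one-component ($3\times3$ stencil) form of the B2 lattice Boussinesq system; $p$ is the lattice parameter of the remaining discrete direction and $b_0$ is a constant parameter of the B2 system. The derivation is a formal expansion in $\delta$, and "leading term" means the lowest-order nontrivial term of this expansion.
   Formalization: The leading term in (ξ,τ) is proved to be 3(∂_ξ−∂_τ)²v, not (∂_ξ−∂_τ)v: v=τ satisfies the leading-order equation but (∂_ξ−∂_τ)v=−1. (∂_ξ−∂_τ)v=0 is shown to imply that equation, and to be equivalent to it for bounded v. *)

theory Defs
  imports
    "HOL-Analysis.Analysis"
    "HOL-Library.Landau_Symbols"
    "HOL-Computational_Algebra.Formal_Laurent_Series"
begin

definition D1 :: "(real \<Rightarrow> real \<Rightarrow> real) \<Rightarrow> real \<Rightarrow> real \<Rightarrow> real" where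
  "D1 f = (\<lambda>a b. deriv (\<lambda>s. f s b) a)"

definition D2 :: "(real \<Rightarrow> real \<Rightarrow> real) \<Rightarrow> real \<Rightarrow> real \<Rightarrow> real" where
  "D2 f = (\<lambda>a b. deriv (\<lambda>s. f a s) b)"

primrec Ck :: "nat \<Rightarrow> (real \<Rightarrow> real \<Rightarrow> real) \<Rightarrow> bool" where
  "Ck 0 f \<longleftrightarrow> continuous_on UNIV (\<lambda>z. f (fst z) (snd z))"
| "Ck (Suc k) f \<longleftrightarrow>
     (\<forall>z. (\<lambda>z. f (fst z) (snd z)) differentiable (at z)) \<and> Ck k (D1 f) \<and> Ck k (D2 f)"

definition smooth :: "(real \<Rightarrow> real \<Rightarrow> real) \<Rightarrow> bool" where
  "smooth f \<longleftrightarrow> (\<forall>k. Ck k f)"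

text \<open>Left-hand side of the semi-discrete three-point equation at \<open>\<xi>\<close>, for functions
  \<open>u \<nu>\<close> of \<open>\<xi>\<close>; only \<open>\<nu> = -1, 0, 1\<close> occur.\<close>

definition three_point :: "real \<Rightarrow> real \<Rightarrow> (int \<Rightarrow> real \<Rightarrow> real) \<Rightarrow> real \<Rightarrow> real" where
  "three_point p b0 u \<xi> =
     deriv (deriv (u 1)) \<xi> + deriv (deriv (u 0)) \<xi> + deriv (deriv (u (-1))) \<xi>
     - 3 * deriv (u 1) \<xi> * (p - u 0 \<xi> + u 1 \<xi>)
     + 3 * deriv (u (-1)) \<xi> * (p - u (-1) \<xi> + u 0 \<xi>)
     + (p - u 0 \<xi> + u 1 \<xi>) ^ 3 - (p - u (-1) \<xi> + u 0 \<xi>) ^ 3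
     - b0 * (deriv (u (-1)) \<xi> - deriv (u 1) \<xi>
             + (2 * p - u (-1) \<xi> + u 1 \<xi>) * (u (-1) \<xi> - 2 * u 0 \<xi> + u 1 \<xi>))"

text \<open>The three-point expression after \<open>p = 1/\<delta>\<close> and \<open>u\<^sub>\<nu>(\<xi>) = v(\<tau> + \<nu>\<delta>, \<xi>)\<close>.\<close>

definition sampled :: "real \<Rightarrow> (real \<Rightarrow> real \<Rightarrow> real) \<Rightarrow> real \<Rightarrow> real \<Rightarrow> real \<Rightarrow> real" where
  "sampled b0 v \<tau> \<xi> \<delta> = three_point (1 / \<delta>) b0 (\<lambda>\<nu> \<xi>. v (\<tau> + of_int \<nu> * \<delta>) \<xi>) \<xi>"

text \<open>The function of \<open>(\<tau>, \<xi>)\<close> given by \<open>w(x, t)\<close> with \<open>x = \<xi> + \<tau>\<close>, \<open>t = \<tau> / p\<close>.\<close>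

definition pull_back :: "real \<Rightarrow> (real \<Rightarrow> real \<Rightarrow> real) \<Rightarrow> real \<Rightarrow> real \<Rightarrow> real" where
  "pull_back p w = (\<lambda>\<tau> \<xi>. w (\<xi> + \<tau>) (\<tau> / p))"

text \<open>The three-point expression in the new variables: evaluated where \<open>\<xi> + \<tau> = x\<close> and
  \<open>\<tau> / p = t\<close>, with \<open>(x, t)\<close> to be held fixed as \<open>\<delta>\<close> tends to 0.\<close>

definition sampled_xt :: "real \<Rightarrow> (real \<Rightarrow> real \<Rightarrow> real) \<Rightarrow> real \<Rightarrow> real \<Rightarrow> real \<Rightarrow> real" where
  "sampled_xt b0 w x t \<delta> =
     (let p = 1 / \<delta>; \<tau> = p * t; \<xi> = x - \<tau> in sampled b0 (pull_back p w) \<tau> \<xi> \<delta>)"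

text \<open>\<open>F\<close> is the expansion of \<open>f\<close> in powers of \<open>\<delta>\<close> at 0 to all orders. No convergence is
  asserted; \<open>F\<close> is determined by \<open>f\<close>, and for smooth \<open>f\<close> it is the Taylor series. As \<open>f\<close> is
  considered only near \<open>\<delta> = 0\<close> but not at it, the value of \<open>1 / \<delta>\<close> at 0 is irrelevant.\<close>

definition has_delta_expansion :: "(real \<Rightarrow> real) \<Rightarrow> real fls \<Rightarrow> bool" where
  "has_delta_expansion f F \<longleftrightarrow>
     (\<forall>N::int. (\<lambda>\<delta>. f \<delta> - (\<Sum>n\<in>{fls_subdegree F..N}. fls_nth F n * \<delta> powi n))
                 \<in> O[at 0](\<lambda>\<delta>. \<delta> powi (N + 1)))"

text \<open>\<open>E v a b\<close> is a function of \<open>\<delta>\<close>. Its lowest-order nontrivial term is \<open>L v a b \<delta>\<^sup>k\<close>: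
  all lower coefficients vanish identically in \<open>v\<close>, the one of order \<open>k\<close> does not.\<close>

definition leading_term ::
  "((real \<Rightarrow> real \<Rightarrow> real) \<Rightarrow> real \<Rightarrow> real \<Rightarrow> real \<Rightarrow> real) \<Rightarrow> int
     \<Rightarrow> ((real \<Rightarrow> real \<Rightarrow> real) \<Rightarrow> real \<Rightarrow> real \<Rightarrow> real) \<Rightarrow> bool" where
  "leading_term E k L \<longleftrightarrow>
     (\<forall>v. smooth v \<longrightarrow> (\<forall>a b. \<exists>F. has_delta_expansion (E v a b) F \<and>
        (\<forall>n<k. fls_nth F n = 0) \<and> fls_nth F k = L v a b)) \<and>
     (\<exists>v a b. smooth v \<and> L v a b \<noteq> 0)"

text \<open>\<open>\<partial>\<^sub>\<xi> - \<partial>\<^sub>\<tau>\<close>, acting on functions of \<open>(\<tau>, \<xi>)\<close> in this order.\<close>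

definition transport :: "(real \<Rightarrow> real \<Rightarrow> real) \<Rightarrow> real \<Rightarrow> real \<Rightarrow> real" where
  "transport v = (\<lambda>\<tau> \<xi>. D2 v \<tau> \<xi> - D1 v \<tau> \<xi>)"

text \<open>In the following two, \<open>v\<close> is a function of \<open>(x, t)\<close> in this order.\<close>

definition boussinesq_xt :: "real \<Rightarrow> (real \<Rightarrow> real \<Rightarrow> real) \<Rightarrow> real \<Rightarrow> real \<Rightarrow> real" where
  "boussinesq_xt b0 v x t =
     D1 (D1 (D1 (D1 v))) x t - 12 * D1 (D1 v) x t * D1 v x t
     - 8 * b0 * D2 (D1 v) x t + 12 * D2 (D2 v) x t"

definition boussinesq_mass :: "real \<Rightarrow> (real \<Rightarrow> real \<Rightarrow> real) \<Rightarrow> real \<Rightarrow> real \<Rightarrow> real" where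
  "boussinesq_mass b0 v x t =
     D1 (D1 (D1 (D1 v))) x t - 12 * D1 (D1 v) x t * D1 v x t
     - (4 / 3) * b0\<^sup>2 * D1 (D1 v) x t + 12 * D2 (D2 v) x t"

text \<open>\<open>w(x + (b0/3) t, t)\<close>, so that \<open>\<partial>\<^sub>t\<close> of it is \<open>\<partial>\<^sub>t + (b0/3) \<partial>\<^sub>x\<close> applied to \<open>w\<close>.\<close>

definition translated :: "real \<Rightarrow> (real \<Rightarrow> real \<Rightarrow> real) \<Rightarrow> real \<Rightarrow> real \<Rightarrow> real" where
  "translated b0 w = (\<lambda>x t. w (x + b0 / 3 * t) t)"

end

theory Submission
  imports Defs
begin

text \<open>
  After multiplication by \<open>\<delta>\<^sup>2\<close> the three-point expression with \<open>p = 1/\<delta>\<close> is a polynomial in \<open>\<delta>\<close> and in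
  the values of smooth functions along the curves \<open>(a \<plusminus> \<delta>, b \<plusminus> \<mu>\<delta>\<^sup>2)\<close>, where \<open>\<mu> = 0\<close> in the variables
  \<open>(\<tau>, \<xi>)\<close> and \<open>\<mu> = 1\<close> in the variables \<open>(x, t)\<close>. Each such function of \<open>\<delta>\<close> has an asymptotic power
  series, obtained by repeated integration, and these series form a ring; so the expansion exists to
  all orders and its low coefficients follow by multiplying power series. In the bounded case,
  \<open>(\<partial>\<^sub>\<xi> - \<partial>\<^sub>\<tau>)\<^sup>2 v = 0\<close> makes \<open>v\<close> affine along the lines \<open>(\<tau> - s, \<xi> + s)\<close>, and a bounded affine
  function is constant.
\<close>

section \<open>Smooth functions of two variables\<close>

lemma smooth_D1: "smooth f \<Longrightarrow> smooth (D1 f)"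
  and smooth_D2: "smooth f \<Longrightarrow> smooth (D2 f)"
  unfolding smooth_def using Ck.simps(2) by blast+

lemma smooth_differentiable: "smooth f \<Longrightarrow> (\<lambda>z. f (fst z) (snd z)) differentiable (at z)"
  unfolding smooth_def using Ck.simps(2) by blast

lemma smooth_continuous: "smooth f \<Longrightarrow> continuous_on UNIV (\<lambda>z. f (fst z) (snd z))"
  unfolding smooth_def using Ck.simps(1) by blast

text \<open>The total derivative \<open>L\<close> exists by smoothness. Composing it with the two
  axis-parallel lines identifies \<open>L (1, 0)\<close> and \<open>L (0, 1)\<close> with the
  partial derivatives, and composing it with the given curve gives the claim by linearity. Hence
  \<open>comp\<close> is stated for arbitrary curves.\<close>

lemma smooth_chain_rule:
  assumes f: "smooth f"
    and X: "(X has_real_derivative X') (at s)" and Y: "(Y has_real_derivative Y') (at s)"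
  shows "((\<lambda>s. f (X s) (Y s)) has_real_derivative X' * D1 f (X s) (Y s) + Y' * D2 f (X s) (Y s)) (at s)"
proof -
  obtain L where L: "((\<lambda>z. f (fst z) (snd z)) has_derivative L) (at (X s, Y s))"
    using smooth_differentiable[OF f] unfolding differentiable_def by blast
  have comp: "((\<lambda>s. f (X s) (Y s)) has_derivative (\<lambda>h. L (h * X', h * Y'))) (at s)"
    if "(X has_real_derivative X') (at s)" "(Y has_real_derivative Y') (at s)"
      "((\<lambda>z. f (fst z) (snd z)) has_derivative L) (at (X s, Y s))" for X Y X' Y' s
  proof -
    have "((\<lambda>s. (X s, Y s)) has_derivative (\<lambda>h. (h * X', h * Y'))) (at s)"
      using that(1,2) by (intro has_derivative_Pair) (simp_all add: has_field_derivative_def mult_commute_abs)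
    from has_derivative_compose[OF this that(3)] show ?thesis by simp
  qed
  interpret L: linear L using L has_derivative_linear by blast
  have scale: "L (h * x, h * y) = h * L (x, y)" for h x y
    using L.scaleR[of h "(x, y)"] by simp
  have "((\<lambda>a. f a (Y s)) has_derivative (\<lambda>h. L (h * 1, h * 0))) (at (X s))"
    using L by (intro comp) auto
  then have "((\<lambda>a. f a (Y s)) has_real_derivative L (1, 0)) (at (X s))"
    unfolding has_field_derivative_def scale by (simp only: mult_commute_abs)
  then have D1: "D1 f (X s) (Y s) = L (1, 0)"
    unfolding D1_def by (rule DERIV_imp_deriv)
  have "(f (X s) has_derivative (\<lambda>h. L (h * 0, h * 1))) (at (Y s))"
    using L by (intro comp) auto
  then have "(f (X s) has_real_derivative L (0, 1)) (at (Y s))"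
    unfolding has_field_derivative_def scale by (simp only: mult_commute_abs)
  then have D2: "D2 f (X s) (Y s) = L (0, 1)"
    unfolding D2_def by (rule DERIV_imp_deriv)
  have "L (X', Y') = X' * L (1, 0) + Y' * L (0, 1)"
    using L.add[of "(X', 0)" "(0, Y')"] scale[of X' 1 0] scale[of Y' 0 1] by simp
  moreover have "((\<lambda>s. f (X s) (Y s)) has_real_derivative L (X', Y')) (at s)"
    using comp[OF X Y L] unfolding has_field_derivative_def scale by (simp only: mult_commute_abs)
  ultimately show ?thesis unfolding D1 D2 by simp
qed

lemma smooth_has_D1: "smooth f \<Longrightarrow> ((\<lambda>a. f a b) has_real_derivative D1 f a b) (at a)"
  using smooth_chain_rule[of f "\<lambda>a. a" 1 a "\<lambda>_. b" 0] by simp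

lemma smooth_has_D2: "smooth f \<Longrightarrow> (f a has_real_derivative D2 f a b) (at b)"
  using smooth_chain_rule[of f "\<lambda>_. a" 0 b "\<lambda>b. b" 1] by simp

section \<open>Symmetry of the mixed partial derivatives\<close>

text \<open>Both values equal \<open>(f(a+h,b+h) - f(a+h,b) - f(a,b+h) + f(a,b)) / h\<^sup>2\<close>.\<close>

lemma D1_D2_common_value:
  assumes f: "smooth f" and h: "h > 0"
  obtains x y x' y' where "a < x" "x < a + h" "b < y" "y < b + h" "a < x'" "x' < a + h" "b < y'" "y' < b + h"
    "D2 (D1 f) x y = D1 (D2 f) x' y'"
proof -
  note d = smooth_has_D1[OF f] smooth_has_D2[OF f]
    smooth_has_D2[OF smooth_D1[OF f]] smooth_has_D1[OF smooth_D2[OF f]]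
  have "\<exists>x>a. x < a + h \<and> (f (a + h) (b + h) - f (a + h) b) - (f a (b + h) - f a b)
      = (a + h - a) * (D1 f x (b + h) - D1 f x b)"
    by (rule MVT2) (use h in \<open>auto intro!: derivative_eq_intros d\<close>)
  then obtain x where x: "a < x" "x < a + h"
    "(f (a + h) (b + h) - f (a + h) b) - (f a (b + h) - f a b) = h * (D1 f x (b + h) - D1 f x b)"
    by auto
  have "\<exists>y>b. y < b + h \<and> D1 f x (b + h) - D1 f x b = (b + h - b) * D2 (D1 f) x y"
    by (rule MVT2) (use h in \<open>auto intro!: d\<close>)
  then obtain y where y: "b < y" "y < b + h" "D1 f x (b + h) - D1 f x b = h * D2 (D1 f) x y"
    by auto
  have "\<exists>y'>b. y' < b + h \<and> (f (a + h) (b + h) - f a (b + h)) - (f (a + h) b - f a b)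
      = (b + h - b) * (D2 f (a + h) y' - D2 f a y')"
    by (rule MVT2) (use h in \<open>auto intro!: derivative_eq_intros d\<close>)
  then obtain y' where y': "b < y'" "y' < b + h"
    "(f (a + h) (b + h) - f a (b + h)) - (f (a + h) b - f a b) = h * (D2 f (a + h) y' - D2 f a y')"
    by auto
  have "\<exists>x'>a. x' < a + h \<and> D2 f (a + h) y' - D2 f a y' = (a + h - a) * D1 (D2 f) x' y'"
    by (rule MVT2) (use h in \<open>auto intro!: d\<close>)
  then obtain x' where x': "a < x'" "x' < a + h" "D2 f (a + h) y' - D2 f a y' = h * D1 (D2 f) x' y'"
    by auto
  have "h * (h * D2 (D1 f) x y) = h * (h * D1 (D2 f) x' y')"
    using x(3) y(3) y'(3) x'(3) by (simp add: algebra_simps)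
  then show thesis using h x y x' y' that by simp
qed

text \<open>In every small square the two mixed derivatives share a value, possibly at different
  points; both are continuous, so shrinking the square forces equality at the corner.\<close>

lemma D1_D2_commute:
  assumes f: "smooth f"
  shows "D1 (D2 f) = D2 (D1 f)"
proof (intro ext)
  fix a b
  have approx: "\<exists>d>0. \<forall>x y. \<bar>x - a\<bar> < d \<and> \<bar>y - b\<bar> < d \<longrightarrow> \<bar>g x y - g a b\<bar> < e"
    if g: "smooth g" and e: "e > 0" for g e
  proof -
    have "continuous (at (a, b)) (\<lambda>z. g (fst z) (snd z))"
      using smooth_continuous[OF g] by (simp add: continuous_on_eq_continuous_at)
    then obtain d where d: "d > 0" "\<And>z. dist z (a, b) < d \<Longrightarrow> \<bar>g (fst z) (snd z) - g a b\<bar> < e"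
      using e unfolding continuous_at_eps_delta by (auto simp: dist_real_def)
    have "\<bar>g x y - g a b\<bar> < e" if "\<bar>x - a\<bar> < d / 2" "\<bar>y - b\<bar> < d / 2" for x y
    proof -
      have "dist (x, y) (a, b) \<le> \<bar>x - a\<bar> + \<bar>y - b\<bar>"
        by (simp add: dist_Pair_Pair dist_real_def sqrt_sum_squares_le_sum_abs)
      with that d(2)[of "(x, y)"] show ?thesis by simp
    qed
    with d(1) show ?thesis by (intro exI[of _ "d / 2"]) auto
  qed
  have "\<bar>D1 (D2 f) a b - D2 (D1 f) a b\<bar> < e" if e: "e > 0" for e
  proof -
    obtain d where d: "d > 0"
      "\<And>x y. \<bar>x - a\<bar> < d \<Longrightarrow> \<bar>y - b\<bar> < d \<Longrightarrow> \<bar>D1 (D2 f) x y - D1 (D2 f) a b\<bar> < e / 2"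
      using approx[OF smooth_D1[OF smooth_D2[OF f]], of "e / 2"] e by auto
    obtain d' where d': "d' > 0"
      "\<And>x y. \<bar>x - a\<bar> < d' \<Longrightarrow> \<bar>y - b\<bar> < d' \<Longrightarrow> \<bar>D2 (D1 f) x y - D2 (D1 f) a b\<bar> < e / 2"
      using approx[OF smooth_D2[OF smooth_D1[OF f]], of "e / 2"] e by auto
    obtain x y x' y' where "a < x" "x < a + min d d'" "b < y" "y < b + min d d'"
      "a < x'" "x' < a + min d d'" "b < y'" "y' < b + min d d'"
      and eq: "D2 (D1 f) x y = D1 (D2 f) x' y'"
      using D1_D2_common_value[OF f, of "min d d'" a b] d(1) d'(1)
      by (metis (no_types, lifting) min_less_iff_conj)
    then have "\<bar>D1 (D2 f) x' y' - D1 (D2 f) a b\<bar> < e / 2" "\<bar>D2 (D1 f) x y - D2 (D1 f) a b\<bar> < e / 2"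
      using d(2)[of x' y'] d'(2)[of x y] by simp_all
    with eq show ?thesis by linarith
  qed
  then have "\<not> \<bar>D1 (D2 f) a b - D2 (D1 f) a b\<bar> > 0" by blast
  then show "D1 (D2 f) a b = D2 (D1 f) a b" by simp
qed

section \<open>Asymptotic power series\<close>

text \<open>The sum stops below \<open>n\<close>, so order 0 expresses boundedness near 0. The
  filter is punctured, so \<open>f 0\<close> is unconstrained.\<close>

definition taylor_upto :: "nat \<Rightarrow> (real \<Rightarrow> real) \<Rightarrow> real fps \<Rightarrow> bool" where
  "taylor_upto n f F \<longleftrightarrow> (\<lambda>\<delta>. f \<delta> - (\<Sum>i<n. fps_nth F i * \<delta> ^ i)) \<in> O[at 0](\<lambda>\<delta>. \<delta> ^ n)"

definition asymp_fps :: "(real \<Rightarrow> real) \<Rightarrow> real fps \<Rightarrow> bool" where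
  "asymp_fps f F \<longleftrightarrow> (\<forall>n. taylor_upto n f F)"

lemma asymp_fps_const: "asymp_fps (\<lambda>_. c) (fps_const c)"
  unfolding asymp_fps_def
proof
  fix n show "taylor_upto n (\<lambda>_. c) (fps_const c)"
    by (cases n) (simp_all add: taylor_upto_def sum.lessThan_Suc_shift del: sum.lessThan_Suc)
qed

lemma asymp_fps_ident: "asymp_fps (\<lambda>\<delta>. \<delta>) fps_X"
  unfolding asymp_fps_def
proof
  fix n :: nat
  have "((\<lambda>\<delta>::real. \<delta>) \<longlongrightarrow> 0) (at 0)" by (rule tendsto_ident_at)
  then have bounded: "(\<lambda>\<delta>::real. \<delta>) \<in> O[at 0](\<lambda>_. 1)"
    by (intro bigoI_tendsto[where c = 0]) simp_all
  have sum: "(\<Sum>i<Suc (Suc m). fps_nth fps_X i * \<delta> ^ i) = \<delta>" for m and \<delta> :: real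
    by (simp add: sum.lessThan_Suc_shift del: sum.lessThan_Suc)
  show "taylor_upto n (\<lambda>\<delta>. \<delta>) fps_X"
  \<comment> \<open>Truncation at order 0 or 1 omits the linear term, so the remainder is \<delta>
    itself; from order 2 on it vanishes.\<close>
  proof (cases "n = 0 \<or> n = 1")
    case True
    with bounded show ?thesis by (auto simp: taylor_upto_def)
  next
    case False
    then obtain m where "n = Suc (Suc m)" by (metis One_nat_def not0_implies_Suc)
    with sum show ?thesis by (simp add: taylor_upto_def del: sum.lessThan_Suc fps_X_nth)
  qed
qed

lemma asymp_fps_add:
  assumes "asymp_fps f F" "asymp_fps g G"
  shows "asymp_fps (\<lambda>\<delta>. f \<delta> + g \<delta>) (F + G)"
  unfolding asymp_fps_def
proof
  fix n
  have "(\<lambda>\<delta>. (f \<delta> - (\<Sum>i<n. fps_nth F i * \<delta> ^ i)) + (g \<delta> - (\<Sum>i<n. fps_nth G i * \<delta> ^ i))) \<in> O[at 0](\<lambda>\<delta>. \<delta> ^ n)"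
    using assms unfolding asymp_fps_def taylor_upto_def by (intro sum_in_bigo(1)) auto
  then show "taylor_upto n (\<lambda>\<delta>. f \<delta> + g \<delta>) (F + G)"
    by (simp add: taylor_upto_def algebra_simps sum.distrib)
qed

text \<open>The truncated Cauchy product is a sum over the triangle \<open>i + j < n\<close>.
  Cutting the inner sum at \<open>n - i\<close> is exactly what the error estimate for products
  needs.\<close>

lemma sum_fps_mult_nth_power:
  fixes F G :: "'a::comm_ring_1 fps"
  shows "(\<Sum>k<n. fps_nth (F * G) k * x ^ k) = (\<Sum>i<n. fps_nth F i * x ^ i * (\<Sum>j<n - i. fps_nth G j * x ^ j))"
proof -
  have "(\<Sum>k<n. fps_nth (F * G) k * x ^ k)
      = (\<Sum>k<n. \<Sum>i\<le>k. fps_nth F i * x ^ i * (fps_nth G (k - i) * x ^ (k - i)))"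
    unfolding fps_mult_nth sum_distrib_right atLeast0AtMost
    by (intro sum.cong refl) (simp add: power_add[symmetric] mult.assoc mult.left_commute)
  also have "\<dots> = (\<Sum>(i,j)\<in>{(i,j). i + j < n}. fps_nth F i * x ^ i * (fps_nth G j * x ^ j))"
    by (rule sum.triangle_reindex[symmetric])
  also have "{(i,j). i + j < n} = (SIGMA i:{..<n}. {..<n - i})"
    by auto
  also have "(\<Sum>(i,j)\<in>(SIGMA i:{..<n}. {..<n - i}). fps_nth F i * x ^ i * (fps_nth G j * x ^ j))
      = (\<Sum>i<n. \<Sum>j<n - i. fps_nth F i * x ^ i * (fps_nth G j * x ^ j))"
    by (rule sum.Sigma[symmetric]) auto
  finally show ?thesis by (simp add: sum_distrib_left)
qed

text \<open>The error splits as (f - F_n) g plus the sum over i < n of F_i \<delta>^i (g - G_(n-i)),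
  where F_n and G_(n-i) are truncations and F_i is a coefficient. The first is O(\<delta>^n) because
  g is bounded, the others because the orders i and n - i add up to n.\<close>

lemma asymp_fps_mult:
  assumes f: "asymp_fps f F" and g: "asymp_fps g G"
  shows "asymp_fps (\<lambda>\<delta>. f \<delta> * g \<delta>) (F * G)"
  unfolding asymp_fps_def
proof
  fix n
  have g0: "g \<in> O[at 0](\<lambda>_. 1)"
    using g[unfolded asymp_fps_def, rule_format, of 0] by (simp add: taylor_upto_def)
  have "(\<lambda>\<delta>. (f \<delta> - (\<Sum>i<n. fps_nth F i * \<delta> ^ i)) * g \<delta>) \<in> O[at 0](\<lambda>\<delta>. \<delta> ^ n * 1)"
    using f g0 unfolding asymp_fps_def taylor_upto_def by (intro landau_o.big.mult) auto
  moreover have "(\<lambda>\<delta>. \<Sum>i<n. fps_nth F i * \<delta> ^ i * (g \<delta> - (\<Sum>j<n - i. fps_nth G j * \<delta> ^ j)))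
      \<in> O[at 0](\<lambda>\<delta>. \<delta> ^ n)"
  proof (rule big_sum_in_bigo)
    fix i assume i: "i \<in> {..<n}"
    have "(\<lambda>\<delta>. fps_nth F i * \<delta> ^ i * (g \<delta> - (\<Sum>j<n - i. fps_nth G j * \<delta> ^ j)))
        \<in> O[at 0](\<lambda>\<delta>. \<delta> ^ i * \<delta> ^ (n - i))"
      using g unfolding asymp_fps_def taylor_upto_def by (intro landau_o.big.mult) auto
    with i show "(\<lambda>\<delta>. fps_nth F i * \<delta> ^ i * (g \<delta> - (\<Sum>j<n - i. fps_nth G j * \<delta> ^ j)))
        \<in> O[at 0](\<lambda>\<delta>. \<delta> ^ n)"
      by (simp add: power_add[symmetric])
  qed
  ultimately have "(\<lambda>\<delta>. (f \<delta> - (\<Sum>i<n. fps_nth F i * \<delta> ^ i)) * g \<delta>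
      + (\<Sum>i<n. fps_nth F i * \<delta> ^ i * (g \<delta> - (\<Sum>j<n - i. fps_nth G j * \<delta> ^ j)))) \<in> O[at 0](\<lambda>\<delta>. \<delta> ^ n)"
    by (intro sum_in_bigo(1)) auto
  then show "taylor_upto n (\<lambda>\<delta>. f \<delta> * g \<delta>) (F * G)"
    unfolding taylor_upto_def sum_fps_mult_nth_power
    by (simp add: left_diff_distrib right_diff_distrib sum_subtractf sum_distrib_right)
qed

lemma asymp_fps_diff:
  assumes "asymp_fps f F" "asymp_fps g G"
  shows "asymp_fps (\<lambda>\<delta>. f \<delta> - g \<delta>) (F - G)"
proof -
  have "F + fps_const (-1) * G = F - G" by (intro fps_ext) simp
  with asymp_fps_add[OF assms(1) asymp_fps_mult[OF asymp_fps_const[of "-1"] assms(2)]]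
  show ?thesis by simp
qed

lemma asymp_fps_numeral: "asymp_fps (\<lambda>_. numeral n) (numeral n)"
  using asymp_fps_const[of "numeral n"] by (simp add: numeral_fps_const)

lemmas asymp_fps_intros = asymp_fps_const asymp_fps_numeral asymp_fps_ident asymp_fps_add
  asymp_fps_diff asymp_fps_mult

section \<open>Taylor expansion along curves by integration\<close>

text \<open>The remainder \<open>r\<close> vanishes at 0 and its derivative is the remainder of
  \<open>f'\<close>, so the mean value theorem gains one power of \<delta>.\<close>

lemma taylor_upto_integrate:
  assumes f: "\<And>\<delta>. (f has_real_derivative f' \<delta>) (at \<delta>)"
    and f': "taylor_upto n f' (fps_deriv F)" and F0: "fps_nth F 0 = f 0"
  shows "taylor_upto (Suc n) f F"
proof -
  define r where "r = (\<lambda>\<delta>. f \<delta> - (\<Sum>i<Suc n. fps_nth F i * \<delta> ^ i))"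
  define r' where "r' = (\<lambda>\<delta>. f' \<delta> - (\<Sum>i<n. fps_nth (fps_deriv F) i * \<delta> ^ i))"
  have r: "(r has_real_derivative r' \<delta>) (at \<delta>)" for \<delta>
  proof -
    have "((\<lambda>\<delta>. \<Sum>i<Suc n. fps_nth F i * \<delta> ^ i) has_real_derivative
        (\<Sum>i<Suc n. fps_nth F i * (real i * \<delta> ^ (i - 1)))) (at \<delta>)"
      by (intro DERIV_sum) (auto intro!: derivative_eq_intros)
    also have "(\<Sum>i<Suc n. fps_nth F i * (real i * \<delta> ^ (i - 1))) = (\<Sum>i<n. fps_nth (fps_deriv F) i * \<delta> ^ i)"
      unfolding sum.lessThan_Suc_shift by (simp add: mult_ac)
    finally show ?thesis unfolding r_def r'_def by (intro DERIV_diff f)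
  qed
  have r0: "r 0 = 0" by (simp add: r_def sum.lessThan_Suc_shift F0 del: sum.lessThan_Suc)
  have "r' \<in> O[at 0](\<lambda>\<delta>. \<delta> ^ n)" using f' by (simp add: taylor_upto_def r'_def)
  then obtain C where C: "C > 0" "eventually (\<lambda>\<delta>. norm (r' \<delta>) \<le> C * norm (\<delta> ^ n)) (at 0)"
    by (elim landau_o.bigE)
  then obtain d where d: "d > 0" "\<And>\<delta>. \<delta> \<noteq> 0 \<Longrightarrow> \<bar>\<delta>\<bar> < d \<Longrightarrow> \<bar>r' \<delta>\<bar> \<le> C * \<bar>\<delta>\<bar> ^ n"
    unfolding eventually_at by (auto simp: dist_real_def power_abs)
  have "\<bar>r \<delta>\<bar> \<le> C * \<bar>\<delta> ^ Suc n\<bar>" if \<delta>: "\<delta> \<noteq> 0" "\<bar>\<delta>\<bar> < d" for \<delta>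
  proof -
    \<comment> \<open>The bound on \<open>r'\<close> holds only off 0, so the intermediate point has
      to be nonzero; on either side of 0 the mean value theorem places it strictly between 0 and
      \<delta>.\<close>
    have "\<exists>z. z \<noteq> 0 \<and> \<bar>z\<bar> \<le> \<bar>\<delta>\<bar> \<and> r \<delta> = \<delta> * r' z"
    proof (cases "\<delta> > 0")
      case True
      then obtain z where "0 < z" "z < \<delta>" "r \<delta> - r 0 = (\<delta> - 0) * r' z"
        using MVT2[of 0 \<delta> r r'] r by blast
      then show ?thesis using r0 by (intro exI[of _ z]) simp
    next
      case False
      with \<delta> obtain z where "\<delta> < z" "z < 0" "r 0 - r \<delta> = (0 - \<delta>) * r' z"
        using MVT2[of \<delta> 0 r r'] r by (metis linorder_neqE_linordered_idom)
      then show ?thesis using r0 by (intro exI[of _ z]) simp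
    qed
    then obtain z where z: "z \<noteq> 0" "\<bar>z\<bar> \<le> \<bar>\<delta>\<bar>" "r \<delta> = \<delta> * r' z" by blast
    have "\<bar>r' z\<bar> \<le> C * \<bar>z\<bar> ^ n" using z \<delta> by (intro d(2)) auto
    also have "\<dots> \<le> C * \<bar>\<delta>\<bar> ^ n" using z C by (intro mult_left_mono power_mono) auto
    finally have "\<bar>\<delta>\<bar> * \<bar>r' z\<bar> \<le> \<bar>\<delta>\<bar> * (C * \<bar>\<delta>\<bar> ^ n)" by (rule mult_left_mono) simp
    then show ?thesis using z by (simp add: abs_mult power_abs mult.left_commute)
  qed
  then have "eventually (\<lambda>\<delta>. norm (r \<delta>) \<le> C * norm (\<delta> ^ Suc n)) (at 0)"
    unfolding eventually_at using d(1) by (auto simp: dist_real_def intro!: exI[of _ d])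
  then have "r \<in> O[at 0](\<lambda>\<delta>. \<delta> ^ Suc n)" by (rule landau_o.bigI[OF C(1)])
  then show ?thesis by (simp add: taylor_upto_def r_def)
qed

text \<open>Taylor coefficients of \<open>w(a + \<nu>\<delta>, b + \<mu>\<delta>\<^sup>2)\<close>; the recursion is read off from its
  \<open>\<delta>\<close>-derivative \<open>\<nu> w\<^sub>1 + 2\<mu>\<delta> w\<^sub>2\<close> along the same curve.\<close>

fun curve_coeff :: "real \<Rightarrow> real \<Rightarrow> real \<Rightarrow> real \<Rightarrow> nat \<Rightarrow> (real \<Rightarrow> real \<Rightarrow> real) \<Rightarrow> real" where
  "curve_coeff \<nu> \<mu> a b 0 w = w a b"
| "curve_coeff \<nu> \<mu> a b (Suc 0) w = \<nu> * D1 w a b"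
| "curve_coeff \<nu> \<mu> a b (Suc (Suc n)) w =
     (\<nu> * curve_coeff \<nu> \<mu> a b (Suc n) (D1 w) + 2 * \<mu> * curve_coeff \<nu> \<mu> a b n (D2 w)) / real (n + 2)"

text \<open>Induction on the order, simultaneously for all smooth functions: the derivative along
  the curve involves only \<open>D1 w\<close> and \<open>D2 w\<close> along the same curve, whose
  expansions are one order shorter.\<close>

lemma asymp_fps_curve:
  assumes "smooth w"
  shows "asymp_fps (\<lambda>\<delta>. w (a + \<nu> * \<delta>) (b + \<mu> * \<delta>\<^sup>2)) (Abs_fps (\<lambda>n. curve_coeff \<nu> \<mu> a b n w))"
    (is "asymp_fps (?f w) (?F w)")
  unfolding asymp_fps_def
proof
  fix n
  have deriv: "(?f w has_real_derivative \<nu> * ?f (D1 w) \<delta> + 2 * \<mu> * \<delta> * ?f (D2 w) \<delta>) (at \<delta>)"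
    if "smooth w" for w \<delta>
    by (rule smooth_chain_rule[OF that, of "\<lambda>\<delta>. a + \<nu> * \<delta>" \<nu> \<delta> "\<lambda>\<delta>. b + \<mu> * \<delta>\<^sup>2" "2 * \<mu> * \<delta>"])
      (auto intro!: derivative_eq_intros)
  have "taylor_upto n (\<lambda>\<delta>. ?f w \<delta>) (?F w)" using assms
  proof (induction n arbitrary: w)
    case 0
    have "isCont (?f w) 0"
      by (rule DERIV_isCont[OF deriv[OF 0]])
    then have "(?f w \<longlongrightarrow> ?f w 0) (at 0)" by (simp add: isCont_def)
    then have "?f w \<in> O[at 0](\<lambda>_. 1)"
      by (intro bigoI_tendsto[where c = "?f w 0"]) simp_all
    then show ?case by (simp add: taylor_upto_def)
  next
    case (Suc n)
    note IH1 = Suc.IH[OF smooth_D1[OF Suc.prems]] and IH2 = Suc.IH[OF smooth_D2[OF Suc.prems]]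
    have coeff: "fps_nth (fps_deriv (?F w)) i = \<nu> * fps_nth (?F (D1 w)) i
        + 2 * \<mu> * (if i = 0 then 0 else fps_nth (?F (D2 w)) (i - 1))" for i
      by (cases i) (simp_all add: field_simps)
    have id: "(\<lambda>\<delta>::real. \<delta>) \<in> O[at 0](\<lambda>_. 1)"
      using asymp_fps_ident[unfolded asymp_fps_def, rule_format, of 0] by (simp add: taylor_upto_def)
    have shifted: "(\<lambda>\<delta>. \<delta> * ?f (D2 w) \<delta> - (\<Sum>i<n. (if i = 0 then 0 else fps_nth (?F (D2 w)) (i - 1)) * \<delta> ^ i))
        \<in> O[at 0](\<lambda>\<delta>. \<delta> ^ n)"
    proof -
      have "(\<lambda>\<delta>. \<delta> * (?f (D2 w) \<delta> - (\<Sum>i<n. fps_nth (?F (D2 w)) i * \<delta> ^ i))) \<in> O[at 0](\<lambda>\<delta>. 1 * \<delta> ^ n)"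
        by (rule landau_o.big.mult[OF id IH2[unfolded taylor_upto_def]])
      \<comment> \<open>Multiplication by \<delta> shifts the truncated series up by one. Its last
        term then has degree n, one too many for the truncation, but it is itself
        O(\<delta>^n).\<close>
      moreover have "(\<lambda>\<delta>. if n = 0 then 0 else fps_nth (?F (D2 w)) (n - 1) * \<delta> ^ n) \<in> O[at 0](\<lambda>\<delta>. \<delta> ^ n)"
        by (cases "n = 0") (simp_all del: curve_coeff.simps)
      ultimately have "(\<lambda>\<delta>. \<delta> * (?f (D2 w) \<delta> - (\<Sum>i<n. fps_nth (?F (D2 w)) i * \<delta> ^ i))
        + (if n = 0 then 0 else fps_nth (?F (D2 w)) (n - 1) * \<delta> ^ n)) \<in> O[at 0](\<lambda>\<delta>. \<delta> ^ n)"
        by (intro sum_in_bigo(1)) auto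
      moreover have "\<delta> * (?f (D2 w) \<delta> - (\<Sum>i<n. fps_nth (?F (D2 w)) i * \<delta> ^ i))
        + (if n = 0 then 0 else fps_nth (?F (D2 w)) (n - 1) * \<delta> ^ n)
        = \<delta> * ?f (D2 w) \<delta> - (\<Sum>i<n. (if i = 0 then 0 else fps_nth (?F (D2 w)) (i - 1)) * \<delta> ^ i)" for \<delta>
      proof (cases n)
        case (Suc m)
        show ?thesis unfolding Suc sum.lessThan_Suc_shift[of "\<lambda>i. (if i = 0 then 0 else _ i) * _ i"]
          by (simp add: algebra_simps sum_distrib_left)
      qed simp
      ultimately show ?thesis by simp
    qed
    have "(\<lambda>\<delta>. \<nu> * (?f (D1 w) \<delta> - (\<Sum>i<n. fps_nth (?F (D1 w)) i * \<delta> ^ i))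
       + (2 * \<mu>) * (\<delta> * ?f (D2 w) \<delta> - (\<Sum>i<n. (if i = 0 then 0 else fps_nth (?F (D2 w)) (i - 1)) * \<delta> ^ i)))
       \<in> O[at 0](\<lambda>\<delta>. \<delta> ^ n)"
      using IH1 shifted unfolding taylor_upto_def
      by (intro sum_in_bigo(1)) (simp_all only: cmult_in_bigo_iff simp_thms)
    then have "taylor_upto n (\<lambda>\<delta>. \<nu> * ?f (D1 w) \<delta> + 2 * \<mu> * \<delta> * ?f (D2 w) \<delta>) (fps_deriv (?F w))"
      unfolding taylor_upto_def coeff
      by (simp add: algebra_simps sum.distrib sum_distrib_left)
    with deriv[OF Suc.prems] show ?case by (rule taylor_upto_integrate) simp
  qed
  then show "taylor_upto n (?f w) (?F w)" .
qed

section \<open>From power series to Laurent expansions\<close>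

lemma has_delta_expansion_shift:
  assumes G: "asymp_fps g G" and f: "\<And>\<delta>. \<delta> \<noteq> 0 \<Longrightarrow> \<delta> ^ k * f \<delta> = g \<delta>"
  shows "has_delta_expansion f (fls_shift (int k) (fps_to_fls G))"
  unfolding has_delta_expansion_def
proof
  fix N :: int
  define F where "F = fls_shift (int k) (fps_to_fls G)"
  \<comment> \<open>For \<open>N\<close> below \<open>- int k - 1\<close> this is 0 by truncation of
    \<open>nat\<close>. The remainder then has order \<open>- int k\<close>, which is better than
    required, so an inequality suffices.\<close>
  define n where "n = nat (N + 1 + int k)"
  have "int n \<ge> N + 1 + int k" by (simp add: n_def)
  have sub: "fls_subdegree F \<ge> - int k"
    using fls_subdegree_fls_to_fps_gt0[of G] by (cases "fps_to_fls G = 0") (auto simp: F_def)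
  have sum: "(\<Sum>m\<in>{fls_subdegree F..N}. fls_nth F m * \<delta> powi m) = (\<Sum>i<n. fps_nth G i * \<delta> ^ i) / \<delta> ^ k"
    if "\<delta> \<noteq> 0" for \<delta>
  proof -
    have pow: "\<delta> ^ nat (m + int k) / \<delta> ^ k = \<delta> powi m" if "- int k \<le> m" for m
    proof -
      have "\<delta> ^ nat (m + int k) = \<delta> powi (m + int k)" using that by (simp add: power_int_def)
      then show ?thesis using \<open>\<delta> \<noteq> 0\<close> by (simp add: power_int_add)
    qed
    \<comment> \<open>The sum may start at \<open>- int k\<close>, since coefficients below the
      subdegree vanish.\<close>
    have "(\<Sum>m\<in>{fls_subdegree F..N}. fls_nth F m * \<delta> powi m) = (\<Sum>m\<in>{- int k..N}. fls_nth F m * \<delta> powi m)"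
      using sub by (intro sum.mono_neutral_left) (auto simp: not_le)
    also have "\<dots> = (\<Sum>i<n. fps_nth G i * (\<delta> ^ i / \<delta> ^ k))"
      by (rule sum.reindex_bij_witness[where i = "\<lambda>i. int i - int k" and j = "\<lambda>m. nat (m + int k)"])
        (auto simp: n_def F_def pow simp del: times_divide_eq_right)
    finally show ?thesis by (simp add: sum_divide_distrib)
  qed
  have "(\<lambda>\<delta>. (g \<delta> - (\<Sum>i<n. fps_nth G i * \<delta> ^ i)) / \<delta> ^ k) \<in> O[at 0](\<lambda>\<delta>. \<delta> ^ n / \<delta> ^ k)"
  proof (rule landau_o.big.divide_right)
    show "eventually (\<lambda>\<delta>::real. \<delta> ^ k \<noteq> 0) (at 0)"
      unfolding eventually_at by (intro exI[of _ 1]) auto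
  qed (use G in \<open>auto simp: asymp_fps_def taylor_upto_def\<close>)
  also have "(\<lambda>\<delta>::real. \<delta> ^ n / \<delta> ^ k) \<in> O[at 0](\<lambda>\<delta>. \<delta> powi (N + 1))"
  proof (rule landau_o.bigI[of 1])
    have "\<bar>\<delta> ^ n / \<delta> ^ k\<bar> \<le> \<bar>\<delta> powi (N + 1)\<bar>" if "\<delta> \<noteq> 0" "\<bar>\<delta>\<bar> < 1" for \<delta> :: real
    proof -
      have "\<delta> ^ n / \<delta> ^ k = \<delta> powi (int n - int k)" using that by (simp add: power_int_diff)
      also have "\<bar>\<dots>\<bar> \<le> \<bar>\<delta> powi (N + 1)\<bar>"
        unfolding power_int_abs using that \<open>int n \<ge> N + 1 + int k\<close>
        by (intro power_int_decreasing) auto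
      finally show ?thesis .
    qed
    then show "eventually (\<lambda>\<delta>::real. norm (\<delta> ^ n / \<delta> ^ k) \<le> 1 * norm (\<delta> powi (N + 1))) (at 0)"
      by (auto simp: eventually_at dist_real_def intro!: exI[of _ 1])
  qed simp
  finally have "(\<lambda>\<delta>. (g \<delta> - (\<Sum>i<n. fps_nth G i * \<delta> ^ i)) / \<delta> ^ k) \<in> O[at 0](\<lambda>\<delta>. \<delta> powi (N + 1))" .
  then show "(\<lambda>\<delta>. f \<delta> - (\<Sum>m\<in>{fls_subdegree F..N}. fls_nth F m * \<delta> powi m)) \<in> O[at 0](\<lambda>\<delta>. \<delta> powi (N + 1))"
  proof (rule landau_o.big.in_cong[THEN iffD2, rotated])
    have "f \<delta> - (\<Sum>m\<in>{fls_subdegree F..N}. fls_nth F m * \<delta> powi m) = (g \<delta> - (\<Sum>i<n. fps_nth G i * \<delta> ^ i)) / \<delta> ^ k"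
      if "\<delta> \<noteq> 0" for \<delta>
      using sum[OF that] f[OF that, symmetric] that by (simp add: field_simps)
    then show "eventually (\<lambda>\<delta>. f \<delta> - (\<Sum>m\<in>{fls_subdegree F..N}. fls_nth F m * \<delta> powi m) = (g \<delta> - (\<Sum>i<n. fps_nth G i * \<delta> ^ i)) / \<delta> ^ k) (at 0)"
      by (auto simp: eventually_at intro!: exI[of _ 1])
  qed
qed

section \<open>Expansion of the three-point expression\<close>

text \<open>\<open>\<delta>\<^sup>2\<close> times the three-point expression for \<open>p = 1/\<delta>\<close>, \<open>z = \<delta>\<close>, \<open>A = u\<^sub>1 - u\<^sub>0\<close>, \<open>B = u\<^sub>0 - u\<^sub>-\<^sub>1\<close>.
  It is polymorphic so that it can be evaluated both on reals and on formal power series.\<close>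

definition stencil :: "'a::comm_ring_1 \<Rightarrow> 'a \<Rightarrow> 'a \<Rightarrow> 'a \<Rightarrow> 'a \<Rightarrow> 'a \<Rightarrow> 'a \<Rightarrow> 'a" where
  "stencil z b A B d d' s =
     z * (z * s) - 3 * (z * (d + z * (d * A))) + 3 * (z * (d' + z * (d' * B)))
     + 3 * (A - B) + 3 * (z * (A * A - B * B)) + z * (z * (A * A * A - B * B * B))
     - b * (z * (z * (d' - d)) + z * ((2 + z * (A + B)) * (A - B)))"

text \<open>In the difference of the cubes the p^3 terms cancel, so no pole beyond \<delta>^(-2) is
  left and the factor \<delta>^2 clears all denominators.\<close>

lemma three_point_eq_stencil:
  assumes "\<delta> \<noteq> 0"
  shows "\<delta> ^ 2 * three_point (1 / \<delta>) b0 u \<xi> =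
    stencil \<delta> b0 (u 1 \<xi> - u 0 \<xi>) (u 0 \<xi> - u (-1) \<xi>) (deriv (u 1) \<xi>) (deriv (u (-1)) \<xi>)
      (deriv (deriv (u 1)) \<xi> + deriv (deriv (u 0)) \<xi> + deriv (deriv (u (-1))) \<xi>)"
proof -
  have "\<delta> ^ 2 * ((1 / \<delta> - x + y) ^ 3 - (1 / \<delta> - z + x) ^ 3)
    = 3 * (y - x - (x - z)) + 3 * (\<delta> * ((y - x) * (y - x) - (x - z) * (x - z)))
      + \<delta> * (\<delta> * ((y - x) * (y - x) * (y - x) - (x - z) * (x - z) * (x - z)))" for x y z
    using assms by (simp add: field_simps power2_eq_square power3_eq_cube)
  note cubes = this[of "u 0 \<xi>" "u 1 \<xi>" "u (-1) \<xi>"]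
  have linear: "\<delta> ^ 2 * (d * (1 / \<delta> - x + y)) = \<delta> * (d + \<delta> * (d * (y - x)))" for d x y
    using assms by (simp add: field_simps power2_eq_square)
  have quadratic: "\<delta> ^ 2 * ((2 * (1 / \<delta>) - x + y) * (x - 2 * c + y))
      = \<delta> * ((2 + \<delta> * ((y - c) + (c - x))) * ((y - c) - (c - x)))" for x y c
    using assms by (simp add: field_simps power2_eq_square)
  have "\<delta> ^ 2 * three_point (1 / \<delta>) b0 u \<xi> =
      \<delta> ^ 2 * (deriv (deriv (u 1)) \<xi> + deriv (deriv (u 0)) \<xi> + deriv (deriv (u (-1))) \<xi>)
      - 3 * (\<delta> ^ 2 * (deriv (u 1) \<xi> * (1 / \<delta> - u 0 \<xi> + u 1 \<xi>)))
      + 3 * (\<delta> ^ 2 * (deriv (u (-1)) \<xi> * (1 / \<delta> - u (-1) \<xi> + u 0 \<xi>)))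
      + \<delta> ^ 2 * ((1 / \<delta> - u 0 \<xi> + u 1 \<xi>) ^ 3 - (1 / \<delta> - u (-1) \<xi> + u 0 \<xi>) ^ 3)
      - b0 * (\<delta> ^ 2 * (deriv (u (-1)) \<xi> - deriv (u 1) \<xi>)
        + \<delta> ^ 2 * ((2 * (1 / \<delta>) - u (-1) \<xi> + u 1 \<xi>) * (u (-1) \<xi> - 2 * u 0 \<xi> + u 1 \<xi>)))"
    unfolding three_point_def by algebra
  then show ?thesis
    unfolding cubes linear quadratic stencil_def by (simp add: power2_eq_square algebra_simps)
qed

lemma asymp_fps_stencil:
  assumes "asymp_fps A FA" "asymp_fps B FB" "asymp_fps d Fd" "asymp_fps d' Fd'" "asymp_fps s Fs"
  shows "asymp_fps (\<lambda>\<delta>. stencil \<delta> b (A \<delta>) (B \<delta>) (d \<delta>) (d' \<delta>) (s \<delta>))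
    (stencil fps_X (fps_const b) FA FB Fd Fd' Fs)"
  unfolding stencil_def by (intro asymp_fps_intros assms)

definition curve_fps :: "real \<Rightarrow> real \<Rightarrow> (real \<Rightarrow> real \<Rightarrow> real) \<Rightarrow> real \<Rightarrow> real \<Rightarrow> real fps" where
  "curve_fps \<nu> \<mu> w a b = Abs_fps (\<lambda>n. curve_coeff \<nu> \<mu> a b n w)"

text \<open>\<open>d\<close> and \<open>s\<close> stand for the first and second \<xi>-derivatives
  of \<open>w\<close>. They are parameters because \<xi> is the second variable in the original
  coordinates, whereas \<partial>_\<xi> = \<partial>_x acts on the first one in the new
  coordinates.\<close>

definition stencil_fps ::
  "real \<Rightarrow> (real \<Rightarrow> real \<Rightarrow> real) \<Rightarrow> (real \<Rightarrow> real \<Rightarrow> real) \<Rightarrow> (real \<Rightarrow> real \<Rightarrow> real) \<Rightarrow> real \<Rightarrow> real \<Rightarrow> real \<Rightarrow> real fps" where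
  "stencil_fps b0 w d s \<mu> a b = stencil fps_X (fps_const b0)
     (curve_fps 1 \<mu> w a b - fps_const (w a b)) (fps_const (w a b) - curve_fps (-1) (-\<mu>) w a b)
     (curve_fps 1 \<mu> d a b) (curve_fps (-1) (-\<mu>) d a b)
     (curve_fps 1 \<mu> s a b + fps_const (s a b) + curve_fps (-1) (-\<mu>) s a b)"

lemma sampled_expansion:
  assumes v: "smooth v"
  shows "has_delta_expansion (sampled b0 v \<tau> \<xi>)
    (fls_shift (int 2) (fps_to_fls (stencil_fps b0 v (D2 v) (D2 (D2 v)) 0 \<tau> \<xi>)))"
proof (rule has_delta_expansion_shift)
  have "asymp_fps (\<lambda>\<delta>. f (\<tau> + \<nu> * \<delta>) \<xi>) (curve_fps \<nu> 0 f \<tau> \<xi>)" if "smooth f" for f \<nu>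
    using asymp_fps_curve[OF that, of \<tau> \<nu> \<xi> 0] by (simp add: curve_fps_def)
  note c = this this[of _ 1, simplified] this[of _ "-1", simplified]
  show "asymp_fps (\<lambda>\<delta>. stencil \<delta> b0 (v (\<tau> + \<delta>) \<xi> - v \<tau> \<xi>) (v \<tau> \<xi> - v (\<tau> - \<delta>) \<xi>)
      (D2 v (\<tau> + \<delta>) \<xi>) (D2 v (\<tau> - \<delta>) \<xi>)
      (D2 (D2 v) (\<tau> + \<delta>) \<xi> + D2 (D2 v) \<tau> \<xi> + D2 (D2 v) (\<tau> - \<delta>) \<xi>))
      (stencil_fps b0 v (D2 v) (D2 (D2 v)) 0 \<tau> \<xi>)"
    unfolding stencil_fps_def minus_zero
    by (intro asymp_fps_stencil asymp_fps_add asymp_fps_diff asymp_fps_const c v smooth_D2)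
next
  fix \<delta> :: real assume "\<delta> \<noteq> 0"
  then show "\<delta> ^ 2 * sampled b0 v \<tau> \<xi> \<delta> = stencil \<delta> b0 (v (\<tau> + \<delta>) \<xi> - v \<tau> \<xi>) (v \<tau> \<xi> - v (\<tau> - \<delta>) \<xi>)
      (D2 v (\<tau> + \<delta>) \<xi>) (D2 v (\<tau> - \<delta>) \<xi>)
      (D2 (D2 v) (\<tau> + \<delta>) \<xi> + D2 (D2 v) \<tau> \<xi> + D2 (D2 v) (\<tau> - \<delta>) \<xi>)"
    unfolding sampled_def by (subst three_point_eq_stencil) (simp_all add: D2_def)
qed

section \<open>The change of variables\<close>

lemma D1_pull_back:
  assumes "smooth w"
  shows "D1 (pull_back p w) \<tau> \<xi> = D1 w (\<xi> + \<tau>) (\<tau> / p) + 1 / p * D2 w (\<xi> + \<tau>) (\<tau> / p)"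
proof -
  have "((\<lambda>\<tau>. w (\<xi> + \<tau>) (\<tau> / p)) has_real_derivative
      1 * D1 w (\<xi> + \<tau>) (\<tau> / p) + 1 / p * D2 w (\<xi> + \<tau>) (\<tau> / p)) (at \<tau>)"
    by (rule smooth_chain_rule[OF assms, of "\<lambda>\<tau>. \<xi> + \<tau>" 1 _ "\<lambda>\<tau>. \<tau> / p" "1 / p"])
      (auto intro!: derivative_eq_intros DERIV_cdivide)
  then show ?thesis unfolding D1_def[of "pull_back p w"] unfolding pull_back_def by (simp add: DERIV_imp_deriv)
qed

text \<open>An equality of functions, so that it can be iterated for the second
  \<xi>-derivative.\<close>

lemma D2_pull_back:
  assumes "smooth w"
  shows "D2 (pull_back p w) = pull_back p (D1 w)"
proof (intro ext)
  fix \<tau> \<xi>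
  have "((\<lambda>\<xi>. w (\<xi> + \<tau>) (\<tau> / p)) has_real_derivative
      1 * D1 w (\<xi> + \<tau>) (\<tau> / p) + 0 * D2 w (\<xi> + \<tau>) (\<tau> / p)) (at \<xi>)"
    by (rule smooth_chain_rule[OF assms, of "\<lambda>\<xi>. \<xi> + \<tau>" 1 _ "\<lambda>_. \<tau> / p" 0])
      (auto intro!: derivative_eq_intros)
  then show "D2 (pull_back p w) \<tau> \<xi> = pull_back p (D1 w) \<tau> \<xi>"
    unfolding D2_def[of "pull_back p w"] unfolding pull_back_def by (simp add: DERIV_imp_deriv)
qed

text \<open>Since t = \<delta>\<tau>, a step \<nu>\<delta> in \<tau> at fixed \<xi> moves x by
  \<nu>\<delta> and t by \<nu>\<delta>^2. This is the parabolic curve with \<mu> = \<nu>.\<close>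

lemma sampled_xt_expansion:
  assumes w: "smooth w"
  shows "has_delta_expansion (sampled_xt b0 w x t)
    (fls_shift (int 2) (fps_to_fls (stencil_fps b0 w (D1 w) (D1 (D1 w)) 1 x t)))"
proof (rule has_delta_expansion_shift)
  have "asymp_fps (\<lambda>\<delta>. f (x + \<nu> * \<delta>) (t + \<mu> * \<delta>\<^sup>2)) (curve_fps \<nu> \<mu> f x t)" if "smooth f" for f \<nu> \<mu>
    using asymp_fps_curve[OF that, of x \<nu> t \<mu>] by (simp add: curve_fps_def)
  note c = this[of _ 1 1, simplified] this[of _ "-1" "-1", simplified]
  show "asymp_fps (\<lambda>\<delta>. stencil \<delta> b0 (w (x + \<delta>) (t + \<delta>\<^sup>2) - w x t) (w x t - w (x - \<delta>) (t - \<delta>\<^sup>2))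
      (D1 w (x + \<delta>) (t + \<delta>\<^sup>2)) (D1 w (x - \<delta>) (t - \<delta>\<^sup>2))
      (D1 (D1 w) (x + \<delta>) (t + \<delta>\<^sup>2) + D1 (D1 w) x t + D1 (D1 w) (x - \<delta>) (t - \<delta>\<^sup>2)))
      (stencil_fps b0 w (D1 w) (D1 (D1 w)) 1 x t)"
    unfolding stencil_fps_def
    by (intro asymp_fps_stencil asymp_fps_add asymp_fps_diff asymp_fps_const c w smooth_D1)
next
  fix \<delta> :: real assume \<delta>: "\<delta> \<noteq> 0"
  define u where "u = (\<lambda>f (\<nu>::int) \<xi>'. pull_back (1 / \<delta>) f (t / \<delta> + of_int \<nu> * \<delta>) \<xi>')"
  have u: "u f \<nu> (x - t / \<delta>) = f (x + of_int \<nu> * \<delta>) (t + of_int \<nu> * \<delta>\<^sup>2)" for f \<nu>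
    using \<delta> by (simp add: u_def pull_back_def distrib_right power2_eq_square mult.assoc)
  have deriv_u: "deriv (u f \<nu>) = u (D1 f) \<nu>" if "smooth f" for f \<nu>
    using D2_pull_back[OF that, of "1 / \<delta>"] unfolding u_def by (auto simp: D2_def fun_eq_iff)
  have "sampled_xt b0 w x t \<delta> = three_point (1 / \<delta>) b0 (u w) (x - t / \<delta>)"
    by (simp add: sampled_xt_def sampled_def u_def Let_def)
  then show "\<delta> ^ 2 * sampled_xt b0 w x t \<delta> =
      stencil \<delta> b0 (w (x + \<delta>) (t + \<delta>\<^sup>2) - w x t) (w x t - w (x - \<delta>) (t - \<delta>\<^sup>2))
      (D1 w (x + \<delta>) (t + \<delta>\<^sup>2)) (D1 w (x - \<delta>) (t - \<delta>\<^sup>2))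
      (D1 (D1 w) (x + \<delta>) (t + \<delta>\<^sup>2) + D1 (D1 w) x t + D1 (D1 w) (x - \<delta>) (t - \<delta>\<^sup>2))"
    using three_point_eq_stencil[OF \<delta>, of b0 "u w" "x - t / \<delta>"]
    by (simp add: deriv_u w smooth_D1 u)
qed

section \<open>Low-order coefficients\<close>

text \<open>Order 4 is enough: the leading order 2 is raised by the factor \<delta>^2. From order 3
  on the recursion produces mixed derivatives in different orders, which smoothness allows to be
  merged.\<close>

lemma curve_fps_nth [simp]:
  "fps_nth (curve_fps \<nu> \<mu> w a b) 0 = w a b"
  "fps_nth (curve_fps \<nu> \<mu> w a b) (Suc 0) = \<nu> * D1 w a b"
  "fps_nth (curve_fps \<nu> \<mu> w a b) (Suc (Suc 0)) = \<nu>\<^sup>2 / 2 * D1 (D1 w) a b + \<mu> * D2 w a b"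
  "smooth w \<Longrightarrow> fps_nth (curve_fps \<nu> \<mu> w a b) (Suc (Suc (Suc 0)))
     = \<nu> ^ 3 / 6 * D1 (D1 (D1 w)) a b + \<nu> * \<mu> * D2 (D1 w) a b"
  "smooth w \<Longrightarrow> fps_nth (curve_fps \<nu> \<mu> w a b) (Suc (Suc (Suc (Suc 0))))
     = \<nu> ^ 4 / 24 * D1 (D1 (D1 (D1 w))) a b + \<nu>\<^sup>2 * \<mu> / 2 * D2 (D1 (D1 w)) a b + \<mu>\<^sup>2 / 2 * D2 (D2 w) a b"
  by (simp_all add: curve_fps_def D1_D2_commute smooth_D1 smooth_D2 field_simps power2_eq_square
      power3_eq_cube power4_eq_xxxx)

text \<open>The forward and backward differences agree to first order, and the derivatives at the
  two neighbours agree at order 0.\<close>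

lemma stencil_fps_nth_0: "fps_nth (stencil_fps b0 w d s \<mu> a b) 0 = 0"
  and stencil_fps_nth_1: "fps_nth (stencil_fps b0 w d s \<mu> a b) (Suc 0) = 0"
  by (simp_all add: stencil_fps_def stencil_def fps_numeral_nth)

lemma stencil_fps_nth_2_fixed_second:
  assumes "smooth v"
  shows "fps_nth (stencil_fps b0 v (D2 v) (D2 (D2 v)) 0 \<tau> \<xi>) (Suc (Suc 0))
    = 3 * (D2 (D2 v) \<tau> \<xi> - 2 * D2 (D1 v) \<tau> \<xi> + D1 (D1 v) \<tau> \<xi>)"
  using assms
  by (simp add: stencil_fps_def stencil_def fps_mult_nth[of _ _ "Suc _"] fps_numeral_nth D1_D2_commute)

text \<open>With \<open>D1 w\<close> as \<xi>-derivative, s, d - d' and A - B contribute 3, -6 and 3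
  times w_xx.\<close>

lemma stencil_fps_nth_2_diagonal:
  assumes "smooth w"
  shows "fps_nth (stencil_fps b0 w (D1 w) (D1 (D1 w)) 1 x t) (Suc (Suc 0)) = 0"
  using assms
  by (simp add: stencil_fps_def stencil_def fps_mult_nth[of _ _ "Suc _"] fps_numeral_nth)

text \<open>The w_xt terms of 3(A - B) and -3(d - d') cancel, as do the two w_xx terms carrying
  \<open>b0\<close>.\<close>

lemma stencil_fps_nth_3_diagonal:
  assumes "smooth w"
  shows "fps_nth (stencil_fps b0 w (D1 w) (D1 (D1 w)) 1 x t) (Suc (Suc (Suc 0))) = 0"
  using assms
  by (simp add: stencil_fps_def stencil_def fps_mult_nth[of _ _ "Suc _"] fps_numeral_nth smooth_D1)

text \<open>The w_xxxx contributions of s, d - d' and A - B are 1 - 1 + 1/4. The term 3 w_tt comes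
  from A - B and reflects 3(\<partial>_\<xi> - \<partial>_\<tau>)^2, as \<partial>_\<xi> -
  \<partial>_\<tau> is now -\<delta>\<partial>_t.\<close>

lemma stencil_fps_nth_4_diagonal:
  assumes "smooth w"
  shows "fps_nth (stencil_fps b0 w (D1 w) (D1 (D1 w)) 1 x t) (Suc (Suc (Suc (Suc 0)))) = 1 / 4 * boussinesq_xt b0 w x t"
  using assms
  by (simp add: stencil_fps_def stencil_def fps_mult_nth[of _ _ "Suc _"] fps_numeral_nth smooth_D1 boussinesq_xt_def algebra_simps)

section \<open>Transport and translation\<close>

lemma transport_along_characteristic:
  assumes v: "smooth v"
  shows "((\<lambda>s. v (\<tau> - s) (\<xi> + s)) has_real_derivative transport v (\<tau> - s) (\<xi> + s)) (at s)"
proof -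
  have "((\<lambda>s. v (\<tau> - s) (\<xi> + s)) has_real_derivative
      -1 * D1 v (\<tau> - s) (\<xi> + s) + 1 * D2 v (\<tau> - s) (\<xi> + s)) (at s)"
    by (rule smooth_chain_rule[OF v, of "\<lambda>s. \<tau> - s" "-1" s "\<lambda>s. \<xi> + s" 1])
      (auto intro!: derivative_eq_intros)
  then show ?thesis by (simp add: transport_def)
qed

lemma transport_transport:
  assumes v: "smooth v"
  shows "transport (transport v) \<tau> \<xi> = D2 (D2 v) \<tau> \<xi> - 2 * D2 (D1 v) \<tau> \<xi> + D1 (D1 v) \<tau> \<xi>"
proof -
  have "D1 (transport v) \<tau> \<xi> = D1 (D2 v) \<tau> \<xi> - D1 (D1 v) \<tau> \<xi>"
    unfolding D1_def[of "transport v"] unfolding transport_def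
    by (intro DERIV_imp_deriv DERIV_diff smooth_has_D1 smooth_D1 smooth_D2 v)
  moreover have "D2 (transport v) \<tau> \<xi> = D2 (D2 v) \<tau> \<xi> - D2 (D1 v) \<tau> \<xi>"
    unfolding D2_def[of "transport v"] unfolding transport_def
    by (intro DERIV_imp_deriv DERIV_diff smooth_has_D2 smooth_D1 smooth_D2 v)
  ultimately show ?thesis
    by (simp add: transport_def[of "transport v"] D1_D2_commute[OF v])
qed

lemma bounded_affine_imp_constant:
  fixes c :: real
  assumes "\<And>s. \<bar>a + c * s\<bar> \<le> M"
  shows "c = 0"
proof (rule ccontr)
  assume "c \<noteq> 0"
  then show False
    \<comment> \<open>The second point gives c s = 2M + 1, and a is at least -M, so a + c s is at
      least M + 1.\<close>
    using assms[of 0] assms[of "(2 * M + 1) / c"] by (auto simp: abs_le_iff)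
qed

lemma bounded_transport_transport_zero:
  assumes v: "smooth v" and M: "\<And>a b. \<bar>v a b\<bar> \<le> M"
    and zero: "\<And>\<tau> \<xi>. transport (transport v) \<tau> \<xi> = 0"
  shows "transport v \<tau> \<xi> = 0"
proof -
  \<comment> \<open>The slope of \<open>v\<close> along the characteristic through (\<tau>, \<xi>);
    its derivative is the second transport derivative, hence 0.\<close>
  define h where "h s = transport v (\<tau> - s) (\<xi> + s)" for s
  have "(h has_real_derivative 0) (at s)" for s
  proof -
    have "(h has_real_derivative (-1 * D1 (D2 v) (\<tau> - s) (\<xi> + s) + 1 * D2 (D2 v) (\<tau> - s) (\<xi> + s))
        - (-1 * D1 (D1 v) (\<tau> - s) (\<xi> + s) + 1 * D2 (D1 v) (\<tau> - s) (\<xi> + s))) (at s)"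
      unfolding h_def transport_def
      by (intro DERIV_diff smooth_chain_rule smooth_D1 smooth_D2 v) (auto intro!: derivative_eq_intros)
    then show ?thesis
      using zero[of "\<tau> - s" "\<xi> + s"]
      by (auto simp: transport_transport[OF v] D1_D2_commute[OF v] elim!: DERIV_cong)
  qed
  then have h: "h s = h 0" for s using DERIV_isconst_all by blast
  have "((\<lambda>s. v (\<tau> - s) (\<xi> + s) - h 0 * s) has_real_derivative 0) (at s)" for s
    using transport_along_characteristic[OF v, of \<tau> \<xi> s] h[of s]
    by (auto intro!: derivative_eq_intros simp: h_def)
  then have along: "v (\<tau> - s) (\<xi> + s) - h 0 * s = v (\<tau> - 0) (\<xi> + 0) - h 0 * 0" for s
    using DERIV_isconst_all by blast
  have "v \<tau> \<xi> + h 0 * s = v (\<tau> - s) (\<xi> + s)" for s using along[of s] by simp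
  with M have "\<bar>v \<tau> \<xi> + h 0 * s\<bar> \<le> M" for s by simp
  then have "h 0 = 0" by (rule bounded_affine_imp_constant)
  then show ?thesis by (simp add: h_def)
qed

section \<open>The translation in x\<close>

lemma D1_translated:
  assumes "smooth w"
  shows "D1 (translated b0 w) = translated b0 (D1 w)"
proof (intro ext)
  fix x t
  have "((\<lambda>x. w (x + b0 / 3 * t) t) has_real_derivative
      1 * D1 w (x + b0 / 3 * t) t + 0 * D2 w (x + b0 / 3 * t) t) (at x)"
    by (rule smooth_chain_rule[OF assms, of "\<lambda>x. x + b0 / 3 * t" 1 _ "\<lambda>_. t" 0])
      (auto intro!: derivative_eq_intros)
  then show "D1 (translated b0 w) x t = translated b0 (D1 w) x t"
    unfolding D1_def[of "translated b0 w"] unfolding translated_def by (simp add: DERIV_imp_deriv)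
qed

lemma translated_has_derivative_snd:
  assumes "smooth w"
  shows "((\<lambda>t. translated b0 w x t) has_real_derivative
    translated b0 (D2 w) x t + 1 / 3 * b0 * translated b0 (D1 w) x t) (at t)"
proof -
  have "((\<lambda>t. w (x + b0 / 3 * t) t) has_real_derivative
      b0 / 3 * D1 w (x + b0 / 3 * t) t + 1 * D2 w (x + b0 / 3 * t) t) (at t)"
    by (rule smooth_chain_rule[OF assms, of "\<lambda>t. x + b0 / 3 * t" "b0 / 3" _ "\<lambda>t. t" 1])
      (auto intro!: derivative_eq_intros)
  then show ?thesis unfolding translated_def by (simp add: add.commute)
qed

lemma D2_translated:
  assumes "smooth w"
  shows "D2 (translated b0 w) = (\<lambda>x t. translated b0 (D2 w) x t + 1 / 3 * b0 * translated b0 (D1 w) x t)"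
  unfolding D2_def[of "translated b0 w"]
  by (intro ext DERIV_imp_deriv translated_has_derivative_snd assms)

lemma D2_D2_translated:
  assumes w: "smooth w"
  shows "D2 (D2 (translated b0 w)) x t = translated b0 (D2 (D2 w)) x t
    + 2 / 3 * b0 * translated b0 (D2 (D1 w)) x t + b0\<^sup>2 / 9 * translated b0 (D1 (D1 w)) x t"
proof -
  have "(D2 (translated b0 w) x has_real_derivative
      (translated b0 (D2 (D2 w)) x t + 1 / 3 * b0 * translated b0 (D1 (D2 w)) x t)
      + 1 / 3 * b0 * (translated b0 (D2 (D1 w)) x t + 1 / 3 * b0 * translated b0 (D1 (D1 w)) x t)) (at t)"
    unfolding D2_translated[OF w]
    by (intro DERIV_add DERIV_cmult translated_has_derivative_snd smooth_D1 smooth_D2 w)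
  then show ?thesis
    unfolding D2_def[of "D2 (translated b0 w)"]
    by (simp add: DERIV_imp_deriv D1_D2_commute[OF w] algebra_simps power2_eq_square)
qed

text \<open>The shift b0/3 is chosen so that 12 (2/3) b0 = 8 b0 cancels the mixed term; the
  coefficients of w_xx add up to (-8/3 + 12/9) b0^2 = -(4/3) b0^2.\<close>

lemma boussinesq_translated:
  assumes w: "smooth w"
  shows "boussinesq_xt b0 (translated b0 w) x t = boussinesq_mass b0 w (x + b0 / 3 * t) t"
  unfolding boussinesq_xt_def boussinesq_mass_def D2_D2_translated[OF w]
  by (simp add: D1_translated D2_translated w smooth_D1)
    (simp add: translated_def algebra_simps power2_eq_square)

section \<open>Leading terms\<close>

lemma smoothI:
  assumes "\<And>z. (\<lambda>z. f (fst z) (snd z)) differentiable (at z)" "smooth (D1 f)" "smooth (D2 f)"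
  shows "smooth f"
  unfolding smooth_def
proof
  fix k show "Ck k f"
    using assms by (cases k)
      (auto simp: smooth_def differentiable_on_def intro!: differentiable_imp_continuous_on differentiable_at_withinI)
qed

lemma smooth_const: "smooth (\<lambda>a b. c)"
proof -
  have "Ck k (\<lambda>a b. c)" for k c
    by (induction k arbitrary: c) (auto simp: D1_def D2_def)
  then show ?thesis by (simp add: smooth_def)
qed

lemma D1_fst_square: "D1 (\<lambda>a b. a\<^sup>2) = (\<lambda>a b. 2 * a)"
  and D1_fst_linear: "D1 (\<lambda>a b. c * a) = (\<lambda>a b. c)"
  and D2_fst: "D2 (\<lambda>a b. g a) = (\<lambda>a b. 0)"
  and D2_snd_square: "D2 (\<lambda>a b. b\<^sup>2) = (\<lambda>a b. 2 * b)"
  and D2_snd_linear: "D2 (\<lambda>a b. c * b) = (\<lambda>a b. c)"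
  and D1_snd: "D1 (\<lambda>a b. g b) = (\<lambda>a b. 0)"
  unfolding D1_def D2_def
  by (auto intro!: ext DERIV_imp_deriv derivative_eq_intros)

lemma smooth_fst_square: "smooth (\<lambda>a b. a\<^sup>2)"
  and smooth_snd_square: "smooth (\<lambda>a b. b\<^sup>2)"
proof -
  have diff: "fst differentiable (at z)" "snd differentiable (at z)" for z :: "real \<times> real"
    by (simp_all add: bounded_linear_imp_differentiable bounded_linear_fst bounded_linear_snd)
  have fst: "smooth (\<lambda>a b. c * a)" for c
    by (rule smoothI) (simp_all add: D1_fst_linear D2_fst smooth_const diff)
  have snd: "smooth (\<lambda>a b. c * b)" for c
    by (rule smoothI) (simp_all add: D2_snd_linear D1_snd smooth_const diff)
  show "smooth (\<lambda>a b. a\<^sup>2)"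
    by (rule smoothI) (simp_all add: D1_fst_square D2_fst smooth_const fst diff)
  show "smooth (\<lambda>a b. b\<^sup>2)"
    by (rule smoothI) (simp_all add: D2_snd_square D1_snd smooth_const snd diff)
qed

lemma leading_termI:
  assumes exp: "\<And>v a b. smooth v \<Longrightarrow> has_delta_expansion (E v a b) (fls_shift (int m) (fps_to_fls (G v a b)))"
    and low: "\<And>v a b i. smooth v \<Longrightarrow> i < k \<Longrightarrow> fps_nth (G v a b) i = 0"
    and lead: "\<And>v a b. smooth v \<Longrightarrow> fps_nth (G v a b) k = L v a b"
    and nontrivial: "smooth v0" "L v0 a0 b0 \<noteq> 0"
  shows "leading_term E (int k - int m) L"
  unfolding leading_term_def
proof (intro conjI allI impI)
  fix v a b assume v: "smooth v"
  have "fls_nth (fls_shift (int m) (fps_to_fls (G v a b))) n = 0" if "n < int k - int m" for n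
    \<comment> \<open>Indices below \<open>- int m\<close> are negative in the power series, where
      its Laurent coefficients vanish.\<close>
    using low[OF v, of "nat (n + int m)"] that by auto
  moreover have "fls_nth (fls_shift (int m) (fps_to_fls (G v a b))) (int k - int m) = L v a b"
    using lead[OF v] by simp
  ultimately show "\<exists>F. has_delta_expansion (E v a b) F \<and> (\<forall>n<int k - int m. fls_nth F n = 0)
      \<and> fls_nth F (int k - int m) = L v a b"
    using exp[OF v] by blast
qed (use nontrivial in blast)

lemma leading_term_sampled: "leading_term (sampled b0) 0 (\<lambda>v \<tau> \<xi>. 3 * transport (transport v) \<tau> \<xi>)"
proof -
  have "leading_term (sampled b0) (int 2 - int 2) (\<lambda>v \<tau> \<xi>. 3 * transport (transport v) \<tau> \<xi>)"
  proof (rule leading_termI)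
    show "has_delta_expansion (sampled b0 v \<tau> \<xi>)
        (fls_shift (int 2) (fps_to_fls (stencil_fps b0 v (D2 v) (D2 (D2 v)) 0 \<tau> \<xi>)))" if "smooth v" for v \<tau> \<xi>
      by (rule sampled_expansion[OF that])
    show "fps_nth (stencil_fps b0 v (D2 v) (D2 (D2 v)) 0 \<tau> \<xi>) i = 0" if "i < 2" for v \<tau> \<xi> i
      using that by (auto simp: less_2_cases_iff stencil_fps_nth_0 stencil_fps_nth_1)
    show "fps_nth (stencil_fps b0 v (D2 v) (D2 (D2 v)) 0 \<tau> \<xi>) 2 = 3 * transport (transport v) \<tau> \<xi>"
      if "smooth v" for v \<tau> \<xi>
      using that by (simp add: numeral_2_eq_2[symmetric] transport_transport
          stencil_fps_nth_2_fixed_second[unfolded numeral_2_eq_2[symmetric]])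
    \<comment> \<open>On \<tau>^2 only the second \<tau>-derivative survives, giving 6.\<close>
    show "smooth (\<lambda>a b. a\<^sup>2)" by (rule smooth_fst_square)
    show "3 * transport (transport (\<lambda>a b. a\<^sup>2)) 0 0 \<noteq> 0"
      by (simp only: transport_transport[OF smooth_fst_square] D1_fst_square D1_fst_linear D2_fst) simp
  qed
  then show ?thesis by simp
qed

lemma leading_term_sampled_xt: "leading_term (sampled_xt b0) 2 (\<lambda>v x t. 1 / 4 * boussinesq_xt b0 v x t)"
proof -
  have "leading_term (sampled_xt b0) (int 4 - int 2) (\<lambda>v x t. 1 / 4 * boussinesq_xt b0 v x t)"
  proof (rule leading_termI)
    have four: "Suc (Suc (Suc (Suc 0))) = 4" by simp
    show "has_delta_expansion (sampled_xt b0 w x t)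
        (fls_shift (int 2) (fps_to_fls (stencil_fps b0 w (D1 w) (D1 (D1 w)) 1 x t)))" if "smooth w" for w x t
      by (rule sampled_xt_expansion[OF that])
    show "fps_nth (stencil_fps b0 w (D1 w) (D1 (D1 w)) 1 x t) i = 0" if w: "smooth w" and "i < 4" for w x t i
    proof -
      from \<open>i < 4\<close> consider "i = 0" | "i = Suc 0" | "i = Suc (Suc 0)" | "i = Suc (Suc (Suc 0))"
        by linarith
      then show ?thesis
        using w by cases (simp_all add: stencil_fps_nth_0 stencil_fps_nth_1
            stencil_fps_nth_2_diagonal stencil_fps_nth_3_diagonal)
    qed
    show "fps_nth (stencil_fps b0 w (D1 w) (D1 (D1 w)) 1 x t) 4 = 1 / 4 * boussinesq_xt b0 w x t"
      if "smooth w" for w x t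
      using stencil_fps_nth_4_diagonal[OF that, of b0 x t]
      by (simp only: four)
    \<comment> \<open>On t^2 only 12 v_tt survives, so the coefficient is nonzero whatever
      \<open>b0\<close> is.\<close>
    show "smooth (\<lambda>a b. b\<^sup>2)" by (rule smooth_snd_square)
    show "1 / 4 * boussinesq_xt b0 (\<lambda>a b. b\<^sup>2) 0 0 \<noteq> 0"
      by (simp only: boussinesq_xt_def D2_snd_square D2_snd_linear D1_snd D2_fst) simp
  qed
  then show ?thesis by simp
qed

theorem mainTheorem7:
  fixes b0 :: real
  shows
    "leading_term (sampled b0) 0 (\<lambda>v \<tau> \<xi>. 3 * transport (transport v) \<tau> \<xi>) \<and>
     (\<forall>v. smooth v \<longrightarrow>
        ((\<forall>\<tau> \<xi>. transport v \<tau> \<xi> = 0) \<longrightarrow> (\<forall>\<tau> \<xi>. 3 * transport (transport v) \<tau> \<xi> = 0)) \<and>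
        (bounded (range (\<lambda>z. v (fst z) (snd z))) \<and>
           (\<forall>\<tau> \<xi>. 3 * transport (transport v) \<tau> \<xi> = 0) \<longrightarrow> (\<forall>\<tau> \<xi>. transport v \<tau> \<xi> = 0))) \<and>
     (\<forall>w p \<tau> \<xi>. smooth w \<and> p \<noteq> 0 \<longrightarrow>
        D2 (pull_back p w) \<tau> \<xi> = D1 w (\<xi> + \<tau>) (\<tau> / p) \<and>
        D1 (pull_back p w) \<tau> \<xi> = D1 w (\<xi> + \<tau>) (\<tau> / p) + 1 / p * D2 w (\<xi> + \<tau>) (\<tau> / p)) \<and>
     leading_term (sampled_xt b0) 2 (\<lambda>v x t. 1 / 4 * boussinesq_xt b0 v x t) \<and>
     (\<forall>w. smooth w \<longrightarrow>
        (\<forall>x t. D1 (translated b0 w) x t = D1 w (x + b0 / 3 * t) t \<and>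
           D2 (translated b0 w) x t = D2 w (x + b0 / 3 * t) t + 1 / 3 * b0 * D1 w (x + b0 / 3 * t) t \<and>
           boussinesq_xt b0 (translated b0 w) x t = boussinesq_mass b0 w (x + b0 / 3 * t) t) \<and>
        ((\<forall>x t. boussinesq_xt b0 (translated b0 w) x t = 0) \<longleftrightarrow>
         (\<forall>x t. boussinesq_mass b0 w x t = 0)))"
proof (intro conjI allI impI)
  fix v :: "real \<Rightarrow> real \<Rightarrow> real" and \<tau> \<xi>
  assume "\<forall>\<tau> \<xi>. transport v \<tau> \<xi> = 0"
  then have "transport v = (\<lambda>\<tau> \<xi>. 0)" by (intro ext) simp
  then show "3 * transport (transport v) \<tau> \<xi> = 0"
    by (simp add: transport_def[of "\<lambda>\<tau> \<xi>. 0"] D1_def D2_def)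
next
  fix v :: "real \<Rightarrow> real \<Rightarrow> real" and \<tau> \<xi>
  assume v: "smooth v" and "bounded (range (\<lambda>z. v (fst z) (snd z))) \<and>
    (\<forall>\<tau> \<xi>. 3 * transport (transport v) \<tau> \<xi> = 0)"
  then have bdd: "bounded (range (\<lambda>z. v (fst z) (snd z)))"
    and zero: "\<And>\<tau> \<xi>. transport (transport v) \<tau> \<xi> = 0" by auto
  from bdd obtain M where "\<And>a b. \<bar>v a b\<bar> \<le> M" by (auto simp: bounded_iff)
  then show "transport v \<tau> \<xi> = 0"
    by (rule bounded_transport_transport_zero[OF v _ zero])
next
  fix w :: "real \<Rightarrow> real \<Rightarrow> real"
  assume w: "smooth w"
  \<comment> \<open>At each t the translation is a bijection in x; inverting it turns the pointwise
    identity into the equivalence of the two equations.\<close>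
  have "boussinesq_mass b0 w x t = boussinesq_xt b0 (translated b0 w) (x - b0 / 3 * t) t" for x t
    by (simp add: boussinesq_translated[OF w])
  then show "(\<forall>x t. boussinesq_xt b0 (translated b0 w) x t = 0) \<longleftrightarrow>
      (\<forall>x t. boussinesq_mass b0 w x t = 0)"
    by (metis boussinesq_translated[OF w])
next
  show "leading_term (sampled_xt b0) 2 (\<lambda>v x t. 1 / 4 * boussinesq_xt b0 v x t)"
    by (rule leading_term_sampled_xt)
qed (simp_all add: leading_term_sampled D2_pull_back D1_pull_back D1_translated
    D2_translated boussinesq_translated, simp_all add: pull_back_def translated_def)

end
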